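(* Every regular scattered $P$-space of weight $\omega_1$ is homeomorphic to a subspace of the ordinal $\omega_2$ equipped with the order topology.
   Context: A topological space is a $P$-space if all its $G_\delta$ subsets are open; regular spaces are assumed to be $T_1$. A space is scattered if every non-empty subspace of it has an isolated point. *)

theory Defs
  imports "HOL-Analysis.Analysis"
begin

unbundle cardinal_syntax

definition P_space :: "'a topology \<Rightarrow> bool" where
  "P_space X \<longleftrightarrow> (\<forall>S. gdelta_in X S \<longrightarrow> openin X S)"

definition isolated_point_of :: "'a topology \<Rightarrow> 'a \<Rightarrow> bool" where
  "isolated_point_of X x \<longleftrightarrow> x \<in> topspace X \<and> openin X {x}"

definition scattered_space :: "'a topology \<Rightarrow> bool" where
  "scattered_space X \<longleftrightarrow>
    (\<forall>S. S \<subseteq> topspace X \<and> S \<noteq> {} \<longrightarrow> (\<exists>x. isolated_point_of (subtopology X S) x))"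

definition base_of :: "'a topology \<Rightarrow> 'a set set \<Rightarrow> bool" where
  "base_of X \<B> \<longleftrightarrow>
    (\<forall>V\<in>\<B>. openin X V) \<and>
    (\<forall>U x. openin X U \<and> x \<in> U \<longrightarrow> (\<exists>V\<in>\<B>. x \<in> V \<and> V \<subseteq> U))"

text \<open>Cardinals are well-order relations compared up to isomorphism, so "the weight of X is k"
  is rendered as a relation: k is the least cardinality of a base of X.\<close>

definition has_weight :: "'a topology \<Rightarrow> 'k rel \<Rightarrow> bool" where
  "has_weight X \<kappa> \<longleftrightarrow>
    (\<exists>\<B>. base_of X \<B> \<and> |\<B>| =o \<kappa>) \<and> (\<forall>\<B>. base_of X \<B> \<longrightarrow> \<kappa> \<le>o |\<B>| )"

text \<open>Initial ordinals as well-order relations. The underlying sets are irrelevant: only the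
  order type matters, and \<^const>\<open>cardSuc\<close> is the successor cardinal as an initial ordinal.\<close>

definition omega_1 :: "nat set rel" where
  "omega_1 = cardSuc natLeq"

definition omega_2 :: "nat set set rel" where
  "omega_2 = cardSuc omega_1"

text \<open>The order topology on the field of a (reflexive) linear order relation, with the open rays
  as subbase.\<close>

definition order_topology_of :: "'a rel \<Rightarrow> 'a topology" where
  "order_topology_of r =
    topology_generated_by (insert (Field r) (underS r ` Field r \<union> aboveS r ` Field r))"

lemma topspace_order_topology_of [simp]: "topspace (order_topology_of r) = Field r"
  by (auto simp: order_topology_of_def underS_def aboveS_def Field_def)

lemma Card_order_omega_1: "Card_order omega_1"
  and Card_order_omega_2: "Card_order omega_2"
  by (simp_all add: omega_1_def omega_2_def natLeq_Card_order cardSuc_Card_order)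

end

theory Submission
  imports Defs
begin

text \<open>
  A map from a space to an ordinal determines the increasing family of the preimages of the closed
  initial segments. For an embedding, these preimages are clopen, and their differences
  form a base. Conversely, the family determines the embedding: a point goes to the position of
  the first member that contains it. So the proof never builds ordinals or sums of ordinals.
  It constructs a family of clopen sets that is well-ordered by inclusion and whose differences
  are a base, here called a clopen ladder (\<open>clopen_ladder\<close>). Only at the end is the ladder,
  as a well-order, compared with \<open>omega_2\<close>
  (\<open>clopen_ladder_embeds_in_order_topology\<close>). The comparison is possible because a ladder has
  essentially no more members than a base of the space (\<open>clopen_ladder_card_le_base\<close>): for
  each member other than the last, the next member contains a basic set that it does not contain.

  Ladders on pieces can be stacked. Let \<open>(G\<^sub>i)\<close> be a family of clopen subsets of \<open>V\<close>, each with a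
  ladder, well-ordered so that every index has countably many predecessors. The union \<open>H\<^sub>i\<close> of the
  sets preceding \<open>G\<^sub>i\<close> is clopen because the space is a \<open>P\<close>-space, and the sets \<open>H\<^sub>i \<union> C\<close>, with
  \<open>C\<close> in the ladder of \<open>G\<^sub>i\<close>, climb through the whole union without any need to make the \<open>G\<^sub>i\<close>
  disjoint (\<open>clopen_ladder_concatenate\<close>). Families of size at most \<open>omega_1\<close> can be ordered in
  this way, and weight \<open>omega_1\<close> makes such families sufficient in two situations:
  when \<open>V\<close> is covered by clopen sets with ladders (\<open>clopen_ladder_cover\<close>), and when \<open>V\<close>
  consists of a point \<open>x\<close> and of clopen sets with ladders that are the complements in \<open>V\<close> of
  small neighbourhoods of \<open>x\<close> (\<open>clopen_ladder_one_point\<close>).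

  Scatteredness finishes the argument without Cantor-Bendixson ranks. Let \<open>G\<close> be the union of
  the open sets all of whose clopen subsets have ladders. If \<open>G\<close> were not the whole space, its
  complement would have an isolated point \<open>x\<close>; if an open neighbourhood of \<open>x\<close> meets the
  complement only in \<open>x\<close>, then its clopen subsets containing \<open>x\<close> fall under the second situation and
  the others under the first, so that \<open>x\<close> would belong to \<open>G\<close>.
\<close>

section \<open>Clopen sets in regular P-spaces\<close>

abbreviation clopen_in :: "'a topology \<Rightarrow> 'a set \<Rightarrow> bool" where
  "clopen_in X K \<equiv> closedin X K \<and> openin X K"

lemma P_space_countable_Union_clopen:
  assumes X: "P_space X" and \<K>: "countable \<K>" "\<And>K. K \<in> \<K> \<Longrightarrow> clopen_in X K"
  shows "clopen_in X (\<Union>\<K>)"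
proof
  show "openin X (\<Union>\<K>)"
    using \<K> by blast
  show "closedin X (\<Union>\<K>)"
  proof (cases "\<K> = {}")
    case False
    have "gdelta_in X (\<Inter>K\<in>\<K>. topspace X - K)"
      using \<K> False by (intro gdelta_in_Inter) (auto intro: open_imp_gdelta_in)
    then have "openin X (\<Inter>K\<in>\<K>. topspace X - K)"
      using X by (auto simp: P_space_def)
    moreover have "(\<Inter>K\<in>\<K>. topspace X - K) = topspace X - \<Union>\<K>"
      using False by auto
    moreover have "\<Union>\<K> \<subseteq> topspace X"
      using \<K>(2) by (meson Union_least closedin_subset)
    ultimately show ?thesis
      by (simp add: closedin_def)
  qed auto
qed

text \<open>Regularity gives open sets and closed sets that alternate in a decreasing sequence inside
  \<open>U\<close>. Their common intersection is closed, and open because it is a \<open>G\<^sub>\<delta>\<close> set.\<close>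

lemma regular_P_space_clopen_neighbourhood:
  assumes reg: "regular_space X" and P: "P_space X" and U: "openin X U" "x \<in> U"
  obtains K where "clopen_in X K" "x \<in> K" "K \<subseteq> U"
proof -
  have "\<exists>W D. openin X W \<and> closedin X D \<and> x \<in> W \<and> W \<subseteq> D \<and> D \<subseteq> V"
    if "openin X V" "x \<in> V" for V
    using reg that unfolding neighbourhood_base_of_closedin [symmetric] neighbourhood_base_of
    by blast
  then obtain w d where wd: "\<And>V. openin X V \<Longrightarrow> x \<in> V \<Longrightarrow>
      openin X (w V) \<and> closedin X (d V) \<and> x \<in> w V \<and> w V \<subseteq> d V \<and> d V \<subseteq> V"
    by metis
  define u where "u n = (w ^^ n) U" for n
  have u: "openin X (u n) \<and> x \<in> u n" for n
    by (induction n) (use U wd in \<open>auto simp: u_def\<close>)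
  have ud: "u (Suc n) \<subseteq> d (u n)" "d (u n) \<subseteq> u n" "closedin X (d (u n))" for n
    using wd [of "u n"] u [of n] by (auto simp: u_def)
  show thesis
  proof
    have "gdelta_in X (\<Inter>n. u n)"
      by (intro gdelta_in_Inter) (use u in \<open>auto intro: open_imp_gdelta_in\<close>)
    moreover have "(\<Inter>n. u n) = (\<Inter>n. d (u n))"
      using ud by blast
    moreover have "closedin X (\<Inter>n. d (u n))"
      using ud by blast
    ultimately show "clopen_in X (\<Inter>n. u n)"
      using P by (simp add: P_space_def)
    show "x \<in> (\<Inter>n. u n)"
      using u by blast
    show "(\<Inter>n. u n) \<subseteq> U"
    proof -
      have "(\<Inter>n. u n) \<subseteq> u 0"
        by (rule INT_lower) simp
      then show ?thesis
        by (simp add: u_def)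
    qed
  qed
qed

section \<open>Clopen ladders\<close>

text \<open>The condition on \<open>\<Inter>\<D>\<close> says that every non-empty subfamily has a least member, so that
  inclusion is a well-order on \<open>\<C>\<close>. The empty set and \<open>V\<close> are members in order
  that initial pieces and final pieces of the ladder are also differences of two members.\<close>

definition clopen_ladder :: "'a topology \<Rightarrow> 'a set \<Rightarrow> 'a set set \<Rightarrow> bool" where
  "clopen_ladder X V \<C> \<longleftrightarrow>
     {} \<in> \<C> \<and> V \<in> \<C> \<and> (\<forall>C\<in>\<C>. C \<subseteq> V \<and> clopen_in X C) \<and>
     (\<forall>\<D>\<subseteq>\<C>. \<D> \<noteq> {} \<longrightarrow> \<Inter>\<D> \<in> \<D>) \<and>
     (\<forall>U x. openin X U \<and> x \<in> U \<inter> V \<longrightarrow> (\<exists>C\<in>\<C>. \<exists>D\<in>\<C>. x \<in> C - D \<and> C - D \<subseteq> U))"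

lemma clopen_ladder_ends:
  "clopen_ladder X V \<C> \<Longrightarrow> {} \<in> \<C>" "clopen_ladder X V \<C> \<Longrightarrow> V \<in> \<C>"
  by (simp_all add: clopen_ladder_def)

lemma clopen_ladder_member:
  assumes "clopen_ladder X V \<C>" "C \<in> \<C>"
  shows "C \<subseteq> V" "clopen_in X C"
  using assms by (simp_all add: clopen_ladder_def)

lemma clopen_ladder_Inter:
  "clopen_ladder X V \<C> \<Longrightarrow> \<D> \<subseteq> \<C> \<Longrightarrow> \<D> \<noteq> {} \<Longrightarrow> \<Inter>\<D> \<in> \<D>"
  by (simp add: clopen_ladder_def)

lemma clopen_ladder_separates:
  assumes "clopen_ladder X V \<C>" "openin X U" "x \<in> U" "x \<in> V"
  obtains C D where "C \<in> \<C>" "D \<in> \<C>" "x \<in> C - D" "C - D \<subseteq> U"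
  using assms unfolding clopen_ladder_def by (meson IntI)

lemma clopen_ladder_linear:
  assumes "clopen_ladder X V \<C>" "C \<in> \<C>" "D \<in> \<C>"
  shows "C \<subseteq> D \<or> D \<subseteq> C"
proof -
  have "\<Inter>{C, D} \<in> {C, D}"
    using assms by (intro clopen_ladder_Inter) auto
  then show ?thesis
    by auto
qed

section \<open>Stacking ladders\<close>

text \<open>The sets \<open>H G \<union> C\<close>, for \<open>C\<close> in the ladder of \<open>G\<close>, run from \<open>H G\<close> to \<open>H G \<union> G\<close>, which is
  contained in \<open>H G'\<close> for every later \<open>G'\<close>; hence they are ordered lexicographically. A point of
  \<open>\<Union>\<G>\<close> is separated inside the first \<open>G\<close> that contains it. The
  last hypothesis deals with the remaining points of \<open>V\<close>: their neighbourhoods contain a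
  final piece of the new ladder.\<close>

lemma clopen_ladder_concatenate:
  assumes P: "P_space X" and V: "clopen_in X V"
    and r: "Well_order r" "Field r = \<G>" "\<And>G. G \<in> \<G> \<Longrightarrow> countable (underS r G)"
    and \<G>: "\<And>G. G \<in> \<G> \<Longrightarrow> G \<subseteq> V" "\<And>G. G \<in> \<G> \<Longrightarrow> clopen_in X G"
      "\<And>G. G \<in> \<G> \<Longrightarrow> \<exists>\<C>. clopen_ladder X G \<C>"
    and tail: "\<And>U x. openin X U \<Longrightarrow> x \<in> U \<Longrightarrow> x \<in> V - \<Union>\<G> \<Longrightarrow> \<exists>G\<in>\<G>. V - G \<subseteq> U"
  shows "\<exists>\<C>. clopen_ladder X V \<C>"
proof -
  obtain L where L: "\<And>G. G \<in> \<G> \<Longrightarrow> clopen_ladder X G (L G)"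
    using \<G>(3) by metis
  define H where "H G = \<Union>(underS r G)" for G
  interpret r: wo_rel r
    using r(1) by (simp only: wo_rel_def)
  have least: "\<exists>a\<in>A. \<forall>b\<in>A. (a, b) \<in> r" if "A \<subseteq> \<G>" "A \<noteq> {}" for A
    using r.minim_in r.minim_least that r(2) by metis
  have underS_sub: "underS r G \<subseteq> \<G>" for G
    using r(2) by (auto simp: underS_def Field_def)
  have H_clopen: "clopen_in X (H G)" if "G \<in> \<G>" for G
    unfolding H_def using that underS_sub r(3) \<G>(2)
    by (intro P_space_countable_Union_clopen [OF P]) blast+
  have H_sub: "H G \<subseteq> V" for G
    using underS_sub \<G>(1) unfolding H_def by blast
  have H_step: "H G \<union> G \<subseteq> H G'" if "(G, G') \<in> r" "G \<noteq> G'" for G G'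
  proof -
    have "underS r G \<subseteq> underS r G'"
      using that by (simp add: underS_incr r.TRANS r.ANTISYM)
    then show ?thesis
      using that unfolding H_def underS_def by blast
  qed
  have LD: "C \<subseteq> G" "clopen_in X C" if "C \<in> L G" "G \<in> \<G>" for C G
    using clopen_ladder_member [OF L [OF that(2)] that(1)] by auto
  have LInter: "\<Inter>\<D> \<in> \<D>" if "\<D> \<subseteq> L G" "\<D> \<noteq> {}" "G \<in> \<G>" for G \<D>
    using clopen_ladder_Inter [OF L] that by blast
  have L0: "{} \<in> L G" "G \<in> L G" if "G \<in> \<G>" for G
    using clopen_ladder_ends [OF L [OF that]] by auto
  define \<C> where "\<C> = {{}, V} \<union> {H G \<union> C |G C. G \<in> \<G> \<and> C \<in> L G}"
  have "clopen_ladder X V \<C>"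
    unfolding clopen_ladder_def
  proof (intro conjI allI impI ballI)
    show "{} \<in> \<C>" "V \<in> \<C>"
      by (auto simp: \<C>_def)
  next
    fix C assume "C \<in> \<C>"
    then consider "C = {}" | "C = V" | G D where "G \<in> \<G>" "D \<in> L G" "C = H G \<union> D"
      unfolding \<C>_def by blast
    then have "C \<subseteq> V \<and> clopen_in X C"
    proof cases
      case 3
      then show ?thesis
        using LD [of D G] H_clopen [of G] H_sub [of G] \<G>(1) [of G] closedin_Un openin_Un by blast
    qed (use V in auto)
    then show "C \<subseteq> V" "closedin X C" "openin X C"
      by auto
  next
    fix \<D> assume \<D>: "\<D> \<subseteq> \<C>" "\<D> \<noteq> {}"
    have \<D>V: "D \<subseteq> V" if "D \<in> \<D>" for D
      using that \<D>(1) LD(1) H_sub \<G>(1) unfolding \<C>_def by blast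
    have "\<exists>D\<in>\<D>. \<forall>E\<in>\<D>. D \<subseteq> E"
    proof -
      define A where "A = {G \<in> \<G>. \<exists>C\<in>L G. H G \<union> C \<in> \<D>}"
      consider "{} \<in> \<D>" | "A = {}" "{} \<notin> \<D>" | "A \<noteq> {}" "{} \<notin> \<D>"
        by blast
      then show ?thesis
      proof cases
        case 2
        then have "\<D> \<subseteq> {V}"
          using \<D>(1) unfolding A_def \<C>_def by blast
        then show ?thesis
          using \<D>(2) by blast
      next
        case 3
        obtain G where G: "G \<in> A" "\<And>G'. G' \<in> A \<Longrightarrow> (G, G') \<in> r"
          using least [of A] 3 unfolding A_def by blast
        define C where "C = \<Inter>{C \<in> L G. H G \<union> C \<in> \<D>}"
        have C: "C \<in> {C \<in> L G. H G \<union> C \<in> \<D>}"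
          unfolding C_def by (rule LInter) (use G(1) A_def in auto)
        have "H G \<union> C \<subseteq> E" if E: "E \<in> \<D>" for E
        proof (cases "E = V")
          case False
          then obtain G' C' where E': "G' \<in> \<G>" "C' \<in> L G'" "E = H G' \<union> C'"
            using \<D>(1) E 3(2) unfolding \<C>_def by blast
          then have "G' \<in> A"
            using E unfolding A_def by blast
          show ?thesis
          proof (cases "G' = G")
            case True
            then show ?thesis
              using E' E unfolding C_def by blast
          next
            case False
            then have "H G \<union> G \<subseteq> H G'"
              using G(2) [OF \<open>G' \<in> A\<close>] by (intro H_step) auto
            moreover have "C \<subseteq> G"
              using C LD(1) G(1) unfolding A_def by blast
            ultimately show ?thesis
              using E' by blast
          qed
        qed (use C \<D>V in blast)
        then show ?thesis
          using C by blast
      qed blast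
    qed
    then obtain D where "D \<in> \<D>" "\<And>E. E \<in> \<D> \<Longrightarrow> D \<subseteq> E"
      by blast
    then have "\<Inter>\<D> = D"
      by blast
    with \<open>D \<in> \<D>\<close> show "\<Inter>\<D> \<in> \<D>"
      by simp
  next
    fix U x assume x: "openin X U \<and> x \<in> U \<inter> V"
    show "\<exists>C\<in>\<C>. \<exists>D\<in>\<C>. x \<in> C - D \<and> C - D \<subseteq> U"
    proof (cases "x \<in> \<Union>\<G>")
      case True
      obtain G where G: "G \<in> \<G>" "x \<in> G" "\<And>G'. G' \<in> \<G> \<Longrightarrow> x \<in> G' \<Longrightarrow> (G, G') \<in> r"
        using least [of "{G \<in> \<G>. x \<in> G}"] True by auto
      have "x \<notin> H G"
      proof
        assume "x \<in> H G"
        then obtain G' where "x \<in> G'" "G' \<noteq> G" "(G', G) \<in> r"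
          unfolding H_def underS_def by blast
        moreover from this have "(G, G') \<in> r"
          using G(3) underS_sub unfolding underS_def by blast
        ultimately show False
          using r.ANTISYM antisymD by metis
      qed
      moreover obtain C D where "C \<in> L G" "D \<in> L G" "x \<in> C - D" "C - D \<subseteq> U"
        using clopen_ladder_separates [OF L [OF G(1)]] x G(2) by blast
      ultimately show ?thesis
        using G(1) unfolding \<C>_def
        by (intro bexI [of _ "H G \<union> C"] bexI [of _ "H G \<union> D"]) auto
    next
      case False
      then obtain G where G: "G \<in> \<G>" "V - G \<subseteq> U"
        using tail x by blast
      have "x \<in> V - (H G \<union> G)"
        using False x G(1) underS_sub unfolding H_def by blast
      moreover have "H G \<union> G \<in> \<C>" "V \<in> \<C>"
        using G(1) L0 unfolding \<C>_def by auto
      ultimately show ?thesis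
        using G(2) by blast
    qed
  qed
  then show ?thesis
    by blast
qed

text \<open>The well-order \<open>|A|\<close> is an initial ordinal, so that a proper initial segment has cardinality
  less than \<open>omega_1\<close>.\<close>

lemma countable_initial_segments_omega_1:
  assumes "|A| \<le>o omega_1"
  shows "countable (underS ( |A| ) a)"
proof (cases "a \<in> A")
  case True
  then have "|underS ( |A| ) a| <o |A|"
    by (intro card_of_underS card_of_Card_order) (simp add: Field_card_of)
  then have "|underS ( |A| ) a| <o cardSuc natLeq"
    using assms unfolding omega_1_def by (rule ordLess_ordLeq_trans)
  then have "|underS ( |A| ) a| \<le>o natLeq"
    by (simp add: cardSuc_ordLeq_ordLess natLeq_Card_order card_of_Card_order)
  then have "|underS ( |A| ) a| \<le>o |UNIV :: nat set|"
    using card_of_nat ordIso_symmetric ordLeq_ordIso_trans by blast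
  then show ?thesis
    by (simp add: card_of_ordLeq [symmetric] countable_def)
next
  case False
  then have "underS ( |A| ) a = {}"
    by (metis Field_card_of underS_empty)
  then show ?thesis
    by simp
qed

lemma clopen_ladder_small_union:
  assumes "P_space X" "clopen_in X V" "|\<G>| \<le>o omega_1"
    and "\<And>G. G \<in> \<G> \<Longrightarrow> G \<subseteq> V" "\<And>G. G \<in> \<G> \<Longrightarrow> clopen_in X G"
      "\<And>G. G \<in> \<G> \<Longrightarrow> \<exists>\<C>. clopen_ladder X G \<C>"
    and "\<And>U x. openin X U \<Longrightarrow> x \<in> U \<Longrightarrow> x \<in> V - \<Union>\<G> \<Longrightarrow> \<exists>G\<in>\<G>. V - G \<subseteq> U"
  shows "\<exists>\<C>. clopen_ladder X V \<C>"
  using assms(1,2) card_of_Well_order Field_card_of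
    countable_initial_segments_omega_1 [OF assms(3)] assms(4-7)
  by (rule clopen_ladder_concatenate)

text \<open>The Lindelof argument: for each basic set that lies in some clopen subset of \<open>V\<close> with a
  ladder, one such subset is chosen. At most \<open>omega_1\<close> sets are chosen, and they cover \<open>V\<close>.\<close>

lemma clopen_ladder_cover:
  assumes P: "P_space X" and V: "clopen_in X V"
    and \<B>: "base_of X \<B>" "|\<B>| \<le>o omega_1"
    and cover: "\<And>x. x \<in> V \<Longrightarrow> \<exists>K \<C>. x \<in> K \<and> K \<subseteq> V \<and> clopen_in X K \<and> clopen_ladder X K \<C>"
  shows "\<exists>\<C>. clopen_ladder X V \<C>"
proof -
  define good where "good B K \<longleftrightarrow> B \<subseteq> K \<and> K \<subseteq> V \<and> clopen_in X K \<and> (\<exists>\<C>. clopen_ladder X K \<C>)"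
    for B K
  define \<G> where "\<G> = (\<lambda>B. SOME K. good B K) ` {B \<in> \<B>. \<exists>K. good B K}"
  have \<G>: "\<exists>B. good B G" if "G \<in> \<G>" for G
    using that unfolding \<G>_def by (auto intro: someI)
  show ?thesis
  proof (rule clopen_ladder_small_union [OF P V])
    have "|\<G>| \<le>o |{B \<in> \<B>. \<exists>K. good B K}|"
      unfolding \<G>_def by (rule card_of_image)
    also have "|{B \<in> \<B>. \<exists>K. good B K}| \<le>o |\<B>|"
      by (rule card_of_mono1) auto
    finally show "|\<G>| \<le>o omega_1"
      using \<B>(2) ordLeq_transitive by blast
  next
    fix U x assume x: "x \<in> V - \<Union>\<G>"
    then obtain K \<C> where K: "x \<in> K" "K \<subseteq> V" "clopen_in X K" "clopen_ladder X K \<C>"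
      using cover by blast
    then obtain B where B: "B \<in> \<B>" "x \<in> B" "B \<subseteq> K"
      using \<B>(1) unfolding base_of_def by blast
    then have "good B K"
      using K unfolding good_def by blast
    then have "good B (SOME K. good B K)"
      by (rule someI)
    then have "x \<in> (SOME K. good B K)"
      using B(2) unfolding good_def by blast
    moreover have "(SOME K. good B K) \<in> \<G>"
      using B(1) \<open>good B K\<close> unfolding \<G>_def by blast
    ultimately have "x \<in> \<Union>\<G>"
      by blast
    with x show "\<exists>G\<in>\<G>. V - G \<subseteq> U"
      by blast
  qed (use \<G> in \<open>auto simp: good_def\<close>)
qed

text \<open>Each basic neighbourhood of \<open>x\<close> is shrunk to a clopen one. The complements in \<open>V\<close>
  of these clopen sets are stacked. They exhaust \<open>V - {x}\<close>, and what lies above them in the ladder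
  shrinks to \<open>x\<close>.\<close>

lemma clopen_ladder_one_point:
  assumes reg: "regular_space X" and t1: "t1_space X" and P: "P_space X"
    and V: "clopen_in X V" and x: "x \<in> V"
    and \<B>: "base_of X \<B>" "|\<B>| \<le>o omega_1"
    and punctured: "\<And>K. clopen_in X K \<Longrightarrow> K \<subseteq> V - {x} \<Longrightarrow> \<exists>\<C>. clopen_ladder X K \<C>"
  shows "\<exists>\<C>. clopen_ladder X V \<C>"
proof -
  have "\<exists>K. clopen_in X K \<and> x \<in> K \<and> K \<subseteq> B" if "B \<in> \<B>" "x \<in> B" for B
    using regular_P_space_clopen_neighbourhood [OF reg P] \<B>(1) that
    unfolding base_of_def by metis
  then obtain k where k: "\<And>B. B \<in> \<B> \<Longrightarrow> x \<in> B \<Longrightarrow> clopen_in X (k B) \<and> x \<in> k B \<and> k B \<subseteq> B"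
    by metis
  define \<G> where "\<G> = (\<lambda>B. V - k B) ` {B \<in> \<B>. x \<in> B}"
  have tail: "\<exists>G\<in>\<G>. V - G \<subseteq> U" if U: "openin X U" "x \<in> U" for U
  proof -
    obtain B where B: "B \<in> \<B>" "x \<in> B" "B \<subseteq> U"
      using \<B>(1) U unfolding base_of_def by blast
    then have "V - (V - k B) \<subseteq> U"
      using k by blast
    then show ?thesis
      using B unfolding \<G>_def by blast
  qed
  show ?thesis
  proof (rule clopen_ladder_small_union [OF P V])
    have "|\<G>| \<le>o |{B \<in> \<B>. x \<in> B}|"
      unfolding \<G>_def by (rule card_of_image)
    also have "|{B \<in> \<B>. x \<in> B}| \<le>o |\<B>|"
      by (rule card_of_mono1) auto
    finally show "|\<G>| \<le>o omega_1"
      using \<B>(2) ordLeq_transitive by blast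
  next
    fix G assume "G \<in> \<G>"
    then obtain B where B: "B \<in> \<B>" "x \<in> B" "G = V - k B"
      unfolding \<G>_def by blast
    have "clopen_in X (V - k B)" "V - k B \<subseteq> V - {x}"
      using k [OF B(1,2)] V by (auto intro: closedin_diff openin_diff)
    then show "clopen_in X G" "\<exists>\<C>. clopen_ladder X G \<C>"
      using punctured B(3) by blast+
  next
    \<comment> \<open>By the T1 axiom some neighbourhood of \<open>x\<close> misses any other point of \<open>V\<close>, so only \<open>x\<close> is
      left outside \<open>\<Union>\<G>\<close>.\<close>
    fix U y assume U: "openin X U" "y \<in> U" and y: "y \<in> V - \<Union>\<G>"
    have "y = x"
    proof (rule ccontr)
      assume "y \<noteq> x"
      moreover have "openin X (topspace X - {y})"
        using t1 openin_subset [OF U(1)] U(2) by (intro openin_diff closedin_t1_singleton) auto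
      moreover have "x \<in> topspace X"
        using V x closedin_subset by blast
      ultimately obtain G where "G \<in> \<G>" "V - G \<subseteq> topspace X - {y}"
        using tail by blast
      then show False
        using y by blast
    qed
    then show "\<exists>G\<in>\<G>. V - G \<subseteq> U"
      using tail U by blast
  qed (auto simp: \<G>_def)
qed

section \<open>Ladders on scattered spaces\<close>

text \<open>Quantifying over all clopen subsets of \<open>U\<close> makes \<open>good\<close> hereditary for open sets by
  definition, so that the pieces of a cover can be shrunk freely.\<close>

proposition scattered_P_space_has_clopen_ladder:
  assumes reg: "regular_space X" and t1: "t1_space X" and sc: "scattered_space X" and P: "P_space X"
    and \<B>: "base_of X \<B>" "|\<B>| \<le>o omega_1"
  shows "\<exists>\<C>. clopen_ladder X (topspace X) \<C>"
proof -
  define good where "good U \<longleftrightarrow> openin X U \<and>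
    (\<forall>K. clopen_in X K \<and> K \<subseteq> U \<longrightarrow> (\<exists>\<C>. clopen_ladder X K \<C>))" for U
  define G where "G = \<Union>{U. good U}"
  have ladder: "\<exists>\<C>. clopen_ladder X K \<C>" if K: "clopen_in X K" "K \<subseteq> G" for K
  proof (rule clopen_ladder_cover [OF P K(1) \<B>])
    fix x assume "x \<in> K"
    then obtain U where U: "good U" "x \<in> U"
      using K(2) unfolding G_def by blast
    then have "openin X (U \<inter> K)"
      using K(1) unfolding good_def by blast
    then obtain K' where "clopen_in X K'" "x \<in> K'" "K' \<subseteq> U \<inter> K"
      using regular_P_space_clopen_neighbourhood [OF reg P] U \<open>x \<in> K\<close> by (metis IntI)
    moreover from this obtain \<C> where "clopen_ladder X K' \<C>"
      using U unfolding good_def by blast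
    ultimately show "\<exists>K' \<C>. x \<in> K' \<and> K' \<subseteq> K \<and> clopen_in X K' \<and> clopen_ladder X K' \<C>"
      by blast
  qed
  have "topspace X - G = {}"
  proof (rule ccontr)
    assume "topspace X - G \<noteq> {}"
    then obtain x where x: "isolated_point_of (subtopology X (topspace X - G)) x"
      using sc unfolding scattered_space_def by (meson Diff_subset)
    then obtain V where V: "openin X V" "{x} = V \<inter> (topspace X - G)"
      unfolding isolated_point_of_def openin_subtopology by blast
    then have punctured: "V - {x} \<subseteq> G"
      using openin_subset [OF V(1)] by blast
    have "\<exists>\<C>. clopen_ladder X K \<C>" if K: "clopen_in X K" "K \<subseteq> V" for K
    proof (cases "x \<in> K")
      case True
      have "\<exists>\<C>. clopen_ladder X K' \<C>" if "clopen_in X K'" "K' \<subseteq> K - {x}" for K'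
        using that K(2) punctured by (intro ladder) auto
      then show ?thesis
        by (rule clopen_ladder_one_point [OF reg t1 P K(1) True \<B>])
    next
      case False
      then have "K \<subseteq> G"
        using K(2) punctured by blast
      then show ?thesis
        using K ladder by blast
    qed
    then have "good V"
      using V(1) by (simp add: good_def)
    then have "V \<subseteq> G"
      unfolding G_def by blast
    then show False
      using V(2) by blast
  qed
  then have "topspace X \<subseteq> G"
    by blast
  then show ?thesis
    by (intro ladder) simp_all
qed

section \<open>From ladders to embeddings\<close>

text \<open>A member \<open>C\<close> other than \<open>V\<close> has an immediate successor \<open>D\<close>, and a point of \<open>D - C\<close> has a
  basic neighbourhood inside \<open>D\<close>. This neighbourhood determines \<open>C\<close>, because it is contained in
  the members above \<open>C\<close> and in no other.\<close>

lemma clopen_ladder_card_le_base: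
  assumes \<C>: "clopen_ladder X V \<C>" and \<B>: "base_of X \<B>" "|\<B>| \<le>o r"
    and r: "Card_order r" "\<not> finite (Field r)"
  shows "|\<C>| \<le>o r"
proof -
  have "\<exists>B\<in>\<B>. \<not> B \<subseteq> C \<and> (\<forall>D\<in>\<C>. C \<subset> D \<longrightarrow> B \<subseteq> D)" if C: "C \<in> \<C> - {V}" for C
  proof -
    define D where "D = \<Inter>{D \<in> \<C>. C \<subset> D}"
    have "V \<in> {D \<in> \<C>. C \<subset> D}"
      using C clopen_ladder_ends [OF \<C>] clopen_ladder_member [OF \<C>] by blast
    then have "D \<in> {D \<in> \<C>. C \<subset> D}"
      unfolding D_def by (intro clopen_ladder_Inter [OF \<C>]) auto
    then obtain x where "x \<in> D - C" "openin X D"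
      using clopen_ladder_member(2) [OF \<C>, of D] by blast
    then obtain B where "B \<in> \<B>" "x \<in> B" "B \<subseteq> D"
      using \<B>(1) unfolding base_of_def by blast
    then show ?thesis
      using \<open>x \<in> D - C\<close> unfolding D_def by blast
  qed
  then obtain b where b: "\<And>C. C \<in> \<C> - {V} \<Longrightarrow> b C \<in> \<B>" "\<And>C. C \<in> \<C> - {V} \<Longrightarrow> \<not> b C \<subseteq> C"
    "\<And>C D. C \<in> \<C> - {V} \<Longrightarrow> D \<in> \<C> \<Longrightarrow> C \<subset> D \<Longrightarrow> b C \<subseteq> D"
    by metis
  have "inj_on b (\<C> - {V})"
  proof (rule inj_onI)
    fix C D assume CD: "C \<in> \<C> - {V}" "D \<in> \<C> - {V}" "b C = b D"
    have "\<not> C \<subset> D" "\<not> D \<subset> C"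
      using b CD by (metis DiffD1)+
    then show "C = D"
      using clopen_ladder_linear [OF \<C>, of C D] CD by blast
  qed
  then have "|\<C> - {V}| \<le>o |\<B>|"
    using b(1) card_of_ordLeq by blast
  then have "|\<C> - {V}| \<le>o r"
    using \<B>(2) ordLeq_transitive by blast
  moreover have "|{V}| \<le>o r"
    using r by (metis card_of_singl_ordLeq finite.emptyI card_of_Field_ordIso ordLeq_ordIso_trans)
  ultimately have "|(\<C> - {V}) \<union> {V}| \<le>o r"
    using r by (intro card_of_Un_ordLeq_infinite_Field) auto
  moreover have "(\<C> - {V}) \<union> {V} = \<C>"
    using clopen_ladder_ends [OF \<C>] by blast
  ultimately show ?thesis
    by simp
qed

text \<open>The ladder, well-ordered by inclusion, is shorter than the initial ordinal \<open>w\<close> and so is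
  isomorphic to an initial segment of \<open>w\<close> by a map \<open>g\<close>. A point \<open>x\<close> goes to \<open>g (m x)\<close>, where
  \<open>m x\<close> is the first member that contains \<open>x\<close>. Then \<open>f x\<close> is at most \<open>g C\<close> exactly
  if \<open>x \<in> C\<close>, so that preimages of rays come from the ladder and images of differences \<open>C - D\<close>
  are traces of intervals.\<close>

lemma clopen_ladder_embeds_in_order_topology:
  assumes t1: "t1_space X" and \<C>: "clopen_ladder X (topspace X) \<C>"
    and w: "Card_order w" and less: "|\<C>| <o w"
  shows "\<exists>S \<subseteq> Field w. X homeomorphic_space subtopology (order_topology_of w) S"
proof -
  have lin: "C \<subseteq> D \<or> D \<subseteq> C" if "C \<in> \<C>" "D \<in> \<C>" for C D
    using clopen_ladder_linear [OF \<C> that] .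
  have Inter: "\<Inter>\<D> \<in> \<D>" if "\<D> \<subseteq> \<C>" "\<D> \<noteq> {}" for \<D>
    using clopen_ladder_Inter [OF \<C> that] .
  have clopen: "C \<subseteq> topspace X" "openin X C" "closedin X C" if "C \<in> \<C>" for C
    using clopen_ladder_member [OF \<C> that] by blast+
  define r where "r = {(C, D). C \<in> \<C> \<and> D \<in> \<C> \<and> C \<subseteq> D}"
  have Fr: "Field r = \<C>"
    unfolding r_def Field_def by auto
  have "wf (r - Id)"
  proof (rule wfI_min)
    fix C \<D> assume "C \<in> (\<D> :: 'a set set)"
    show "\<exists>D\<in>\<D>. \<forall>E. (E, D) \<in> r - Id \<longrightarrow> E \<notin> \<D>"
    proof (cases "\<D> \<inter> \<C> = {}")
      case True
      then show ?thesis
        using \<open>C \<in> \<D>\<close> unfolding r_def by blast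
    next
      case False
      then have "\<Inter>(\<D> \<inter> \<C>) \<in> \<D> \<inter> \<C>"
        by (intro Inter) auto
      then show ?thesis
        unfolding r_def by (intro bexI [of _ "\<Inter>(\<D> \<inter> \<C>)"]) blast+
    qed
  qed
  moreover have "linear_order_on \<C> r"
    unfolding order_on_defs r_def using lin
    by (auto simp: refl_on_def trans_def antisym_def total_on_def)
  ultimately have wo: "Well_order r"
    unfolding well_order_on_def Fr by blast
  have wow: "Well_order w"
    using w by (simp add: card_order_on_def)
  have "\<not> w \<le>o r"
  proof
    assume "w \<le>o r"
    then have "|Field w| \<le>o |\<C>|"
      using card_of_mono2 Fr by metis
    then have "w \<le>o |\<C>|"
      using w card_of_Field_ordIso ordIso_ordLeq_trans ordIso_symmetric by blast
    then show False
      using less not_ordLess_ordLeq by blast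
  qed
  then have "r <o w"
    using wo wow not_ordLeq_iff_ordLess by blast
  then obtain g where "embed r w g"
    unfolding ordLess_def embedS_def by blast
  then have g: "compat r w g" "inj_on g \<C>" "wo_rel.ofilter w (g ` \<C>)"
    using embed_iff_compat_inj_on_ofilter [OF wo wow] Fr by metis+
  interpret w: wo_rel w
    using wow by (simp only: wo_rel_def)
  have gF: "g C \<in> Field w" and down: "\<And>a. (a, g C) \<in> w \<Longrightarrow> a \<in> g ` \<C>" if "C \<in> \<C>" for C
    using g(3) that unfolding w.ofilter_def under_def by blast+
  have g_le: "(g C, g D) \<in> w \<longleftrightarrow> C \<subseteq> D" if CD: "C \<in> \<C>" "D \<in> \<C>" for C D
  proof -
    have mono: "(g C, g D) \<in> w" if "C \<in> \<C>" "D \<in> \<C>" "C \<subseteq> D" for C D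
      using g(1) that by (simp add: compat_def r_def)
    show ?thesis
    proof
      assume le: "(g C, g D) \<in> w"
      show "C \<subseteq> D"
      proof (rule ccontr)
        assume "\<not> C \<subseteq> D"
        then have "(g D, g C) \<in> w"
          using mono [OF CD(2,1)] lin [OF CD] by blast
        then have "g C = g D"
          using le w.ANTISYM antisymD by metis
        then show False
          using \<open>\<not> C \<subseteq> D\<close> CD g(2) by (auto dest: inj_onD)
      qed
    qed (use CD mono in blast)
  qed
  define m where "m x = \<Inter>{C \<in> \<C>. x \<in> C}" for x
  have m: "m x \<in> \<C>" "x \<in> m x" if "x \<in> topspace X" for x
  proof -
    have "m x \<in> {C \<in> \<C>. x \<in> C}"
      unfolding m_def using clopen_ladder_ends [OF \<C>] that by (intro Inter) auto
    then show "m x \<in> \<C>" "x \<in> m x"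
      by auto
  qed
  have m_le: "m x \<subseteq> C \<longleftrightarrow> x \<in> C" if "x \<in> topspace X" "C \<in> \<C>" for x C
    using m [OF that(1)] that(2) unfolding m_def by blast
  define f where "f x = g (m x)" for x
  have f_le: "(f x, g C) \<in> w \<longleftrightarrow> x \<in> C" if "x \<in> topspace X" "C \<in> \<C>" for x C
    unfolding f_def using g_le [OF m(1) [OF that(1)] that(2)] m_le [OF that] by simp
  have f_gt: "f x \<in> aboveS w (g C) \<longleftrightarrow> x \<notin> C" if "x \<in> topspace X" "C \<in> \<C>" for x C
  proof -
    have "f x \<in> aboveS w (g C) \<longleftrightarrow> (f x, g C) \<notin> w"
      using gF [OF that(2)] gF [OF m(1) [OF that(1)]] w.TOTALS w.ANTISYM antisymD
      unfolding aboveS_def f_def mem_Collect_eq by metis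
    then show ?thesis
      using f_le [OF that] by simp
  qed
  let ?Y = "order_topology_of w" and ?S = "f ` topspace X"
  have SF: "?S \<subseteq> Field w"
    using m gF by (auto simp: f_def)
  have cont: "continuous_map X ?Y f"
    unfolding order_topology_of_def
  proof (rule continuous_on_generated_topo)
    \<comment> \<open>A lower ray pulls back to a union of ladder members, whether or not its end point is in the
      range of \<open>g\<close>. For upper rays, an end point outside the range bounds the whole
      range, since the range is an initial segment.\<close>
    fix A assume "A \<in> insert (Field w) (underS w ` Field w \<union> aboveS w ` Field w)"
    then consider "A = Field w" | a where "A = underS w a" | a where "a \<in> Field w" "A = aboveS w a"
      by blast
    then show "openin X (f -` A \<inter> topspace X)"
    proof cases
      case 1
      then have "f -` A \<inter> topspace X = topspace X"
        using SF by blast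
      then show ?thesis
        by simp
    next
      case 2
      have "f -` A \<inter> topspace X = \<Union>{C \<in> \<C>. g C \<in> underS w a}" (is "?L = ?R")
      proof
        show "?L \<subseteq> ?R"
          using m unfolding f_def 2 by blast
        show "?R \<subseteq> ?L"
        proof
          fix x assume "x \<in> ?R"
          then obtain C where C: "C \<in> \<C>" "x \<in> C" "g C \<in> underS w a"
            by blast
          then have x: "x \<in> topspace X"
            using clopen by blast
          then have fx: "(f x, g C) \<in> w"
            using f_le C by blast
          have a: "(g C, a) \<in> w" "g C \<noteq> a"
            using C(3) unfolding underS_def by auto
          have "(f x, a) \<in> w"
            using fx a(1) by (rule transD [OF w.TRANS])
          moreover have "f x \<noteq> a"
            using antisymD [OF w.ANTISYM fx] a by auto
          ultimately have "f x \<in> underS w a"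
            unfolding underS_def by blast
          then show "x \<in> ?L"
            using x 2 by blast
        qed
      qed
      then show ?thesis
        using clopen by auto
    next
      case 3
      show ?thesis
      proof (cases "a \<in> g ` \<C>")
        case True
        then obtain C where C: "C \<in> \<C>" "a = g C"
          by blast
        then have "f -` A \<inter> topspace X = topspace X - C"
          using f_gt 3 by auto
        then show ?thesis
          using clopen C by auto
      next
        case False
        then have "f -` A \<inter> topspace X = {}"
          using down m unfolding 3 aboveS_def f_def by blast
        then show ?thesis
          by simp
      qed
    qed
  qed (use SF in auto)
  have subbase: "openin ?Y (Field w)" "\<And>a. a \<in> Field w \<Longrightarrow> openin ?Y (underS w a)"
    "\<And>a. a \<in> Field w \<Longrightarrow> openin ?Y (aboveS w a)"
    unfolding order_topology_of_def by (auto intro!: topology_generated_by_Basis)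
  have image_diff: "openin (subtopology ?Y ?S) (f ` (C - D))" if CD: "C \<in> \<C>" "D \<in> \<C>" for C D
  proof -
    have "\<exists>W. openin ?Y W \<and> (\<forall>x\<in>topspace X. f x \<in> W \<longleftrightarrow> x \<in> C)"
    proof (cases "C = topspace X")
      case True
      then show ?thesis
        using subbase(1) SF by (intro exI [of _ "Field w"]) auto
    next
      case False
      \<comment> \<open>The closed segment below \<open>g C\<close> meets the image of \<open>f\<close> as does the open ray
        below the next step of the ladder.\<close>
      define C' where "C' = \<Inter>{E \<in> \<C>. C \<subset> E}"
      have "topspace X \<in> {E \<in> \<C>. C \<subset> E}"
        using clopen_ladder_ends [OF \<C>] False clopen(1) [OF CD(1)] by blast
      then have C': "C' \<in> {E \<in> \<C>. C \<subset> E}"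
        unfolding C'_def by (intro Inter) auto
      have "f x \<in> underS w (g C') \<longleftrightarrow> x \<in> C" if x: "x \<in> topspace X" for x
      proof
        assume "f x \<in> underS w (g C')"
        then have "m x \<subset> C'"
          using g_le m(1) [OF x] C' unfolding underS_def f_def by auto
        then have "\<not> C \<subset> m x"
          using m(1) [OF x] unfolding C'_def by blast
        then show "x \<in> C"
          using lin [OF CD(1) m(1) [OF x]] m(2) [OF x] by blast
      next
        assume "x \<in> C"
        then have "m x \<subseteq> C"
          using m_le x CD by blast
        then have "m x \<noteq> C'" "m x \<subseteq> C'"
          using C' by auto
        then show "f x \<in> underS w (g C')"
          using C' g_le m(1) [OF x] g(2) unfolding underS_def f_def by (auto dest: inj_onD)
      qed
      moreover have "openin ?Y (underS w (g C'))"
        using C' gF subbase(2) by blast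
      ultimately show ?thesis
        by blast
    qed
    then obtain W where W: "openin ?Y W" "\<And>x. x \<in> topspace X \<Longrightarrow> f x \<in> W \<longleftrightarrow> x \<in> C"
      by blast
    have "f ` (C - D) = (W \<inter> aboveS w (g D)) \<inter> ?S"
      using W(2) f_gt CD(2) clopen(1) [OF CD(1)] by (auto 4 4)
    moreover have "openin ?Y (W \<inter> aboveS w (g D))"
      using W(1) subbase(3) gF [OF CD(2)] by blast
    ultimately show ?thesis
      unfolding openin_subtopology by blast
  qed
  have sep: "\<exists>C\<in>\<C>. \<exists>D\<in>\<C>. x \<in> C - D \<and> C - D \<subseteq> U" if "openin X U" "x \<in> U" for U x
  proof (rule clopen_ladder_separates [OF \<C> that])
    show "x \<in> topspace X"
      using openin_subset [OF that(1)] that(2) by blast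
  qed blast
  have "open_map X (subtopology ?Y ?S) f"
    unfolding open_map_def
  proof (intro allI impI)
    fix U assume U: "openin X U"
    have "\<exists>T. openin (subtopology ?Y ?S) T \<and> y \<in> T \<and> T \<subseteq> f ` U" if "y \<in> f ` U" for y
    proof -
      obtain x where x: "x \<in> U" "y = f x"
        using \<open>y \<in> f ` U\<close> by blast
      then obtain C D where "C \<in> \<C>" "D \<in> \<C>" "x \<in> C - D" "C - D \<subseteq> U"
        using sep [OF U] by blast
      then show ?thesis
        using image_diff [of C D] x by (intro exI [of _ "f ` (C - D)"]) auto
    qed
    then show "openin (subtopology ?Y ?S) (f ` U)"
      by (subst openin_subopen) simp
  qed
  moreover have "continuous_map X (subtopology ?Y ?S) f"
    using cont by (simp add: continuous_map_in_subtopology)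
  moreover have "inj_on f (topspace X)"
  proof (rule inj_onI, rule ccontr)
    fix x y assume xy: "x \<in> topspace X" "y \<in> topspace X" "f x = f y" "x \<noteq> y"
    have "closedin X {y}"
      using t1 xy by (simp add: closedin_t1_singleton)
    then have "openin X (topspace X - {y})"
      by (simp add: openin_diff)
    moreover have "x \<in> topspace X - {y}"
      using xy by blast
    ultimately obtain C D where CD: "C \<in> \<C>" "D \<in> \<C>" "x \<in> C - D" "C - D \<subseteq> topspace X - {y}"
      using sep by blast
    have "y \<in> E \<longleftrightarrow> x \<in> E" if "E \<in> \<C>" for E
      using f_le [OF xy(1) that] f_le [OF xy(2) that] xy(3) by simp
    then show False
      using CD by blast
  qed
  moreover have "?S = topspace (subtopology ?Y ?S)"
    using SF by auto
  ultimately have "homeomorphic_map X (subtopology ?Y ?S) f"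
    by (intro bijective_open_imp_homeomorphic_map)
  then show ?thesis
    using SF homeomorphic_map_imp_homeomorphic_space by blast
qed

theorem theorem6:
  fixes X :: "'a topology"
  assumes "regular_space X" and "t1_space X"
    and "scattered_space X"
    and "P_space X"
    and "has_weight X omega_1"
  shows "\<exists>S. S \<subseteq> topspace (order_topology_of omega_2) \<and>
    X homeomorphic_space subtopology (order_topology_of omega_2) S"
proof -
  obtain \<B> where \<B>: "base_of X \<B>" "|\<B>| \<le>o omega_1"
    using assms(5) ordIso_iff_ordLeq unfolding has_weight_def by blast
  obtain \<C> where \<C>: "clopen_ladder X (topspace X) \<C>"
    using scattered_P_space_has_clopen_ladder [OF assms(1-4) \<B>] by blast
  have inf: "\<not> finite (Field omega_1)"
    unfolding omega_1_def
    using Cinfinite_cardSuc [OF natLeq_Cinfinite] by (simp add: cinfinite_def)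
  have "|\<C>| \<le>o omega_1"
    using clopen_ladder_card_le_base [OF \<C> \<B> Card_order_omega_1 inf] .
  also have "omega_1 <o omega_2"
    unfolding omega_2_def by (rule cardSuc_greater [OF Card_order_omega_1])
  finally show ?thesis
    using clopen_ladder_embeds_in_order_topology [OF assms(2) \<C> Card_order_omega_2] by simp
qed

end
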